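(* Let $\mathcal G$ be the space of proper convex lower semicontinuous functions over a (real) locally convex Hausdorff topological vector space $X$. Then the order isomorphisms over $\mathcal G$ are affine: for every order isomorphism $J:\mathcal G\to\mathcal G$ there exist a linear map $A:X\to X$ with w*-w* continuous adjoint, which has an inverse with w*-w* continuous adjoint, and constants $c\in X$, $b\in X^*$, $d,\delta\in\mathbb R$ with $d>0$ such that, for all $f\in\mathcal G$ and $x\in X$, $$Jf(x)=\langle b,x\rangle+\delta+d\cdot f(Ax+c).$$ Conversely, every map $J$ of this form is an order isomorphism over $\mathcal G$; thus these $J$ are the only order isomorphisms over $\mathcal G$.
   Context: $X^*$ is the space of continuous linear forms on $X$, with duality product $\langle\cdot,\cdot\rangle:X^*\times X\to\mathbb R$. A function $f:X\to[-\infty,+\infty]$ is proper if it never takes the value $-\infty$ and is not identically $+\infty$. An order isomorphism over $\mathcal G$ is an invertible map $J:\mathcal G\to\mathcal G$ with $f\ge h\Leftrightarrow Jf\ge Jh$ (pointwise order). A linear map $A:X\to X$ has a w*-w* continuous adjoint if there is a map $A^*:X^*\to X^*$ with $\langle A^*p,x\rangle=\langle p,Ax\rangle$ for all $p\in X^*$, $x\in X$, that is continuous for the weak-* topology on both sides.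
   Formalization: The claim that every order isomorphism is affine is proved for X ≠ {0}; for X = {0} it is false, since the functions are then real constants and, e.g., f ↦ f³ is a non-affine order isomorphism. The converse is proved for all X. *)

theory Defs
  imports "HOL-Analysis.Analysis"
begin

text \<open>The constant \<open>convex\<close> has a sort constraint that class specifications do not allow, so its
  definition is written out here; \<open>convex_nhds_zero\<close> below restates the axiom.\<close>

class locally_convex_space = real_vector + t2_space + topological_ab_group_add +
  assumes tendsto_scaleR_Pair: "LIM z (nhds r \<times>\<^sub>F nhds x). fst z *\<^sub>R snd z :> nhds (r *\<^sub>R x)"
    and convex_nhds_zero_raw: "open U \<Longrightarrow> 0 \<in> U \<Longrightarrow>
      \<exists>V. open V \<and> (\<forall>x\<in>V. \<forall>y\<in>V. \<forall>u\<ge>0. \<forall>v\<ge>0. u + v = 1 \<longrightarrow> u *\<^sub>R x + v *\<^sub>R y \<in> V) \<and>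
        0 \<in> V \<and> V \<subseteq> U"

lemma convex_nhds_zero:
  fixes U :: "'a::locally_convex_space set"
  assumes "open U" "0 \<in> U"
  shows "\<exists>V. open V \<and> convex V \<and> 0 \<in> V \<and> V \<subseteq> U"
  unfolding convex_def using convex_nhds_zero_raw[OF assms] .

instance real_normed_vector \<subseteq> locally_convex_space
proof
  fix r :: real and x :: 'a
  show "LIM z (nhds r \<times>\<^sub>F nhds x). fst z *\<^sub>R snd z :> nhds (r *\<^sub>R x)"
    by (intro tendsto_scaleR filterlim_fst filterlim_snd)
next
  fix U :: "'a set"
  assume "open U" "0 \<in> U"
  then obtain e where "e > 0" "ball 0 e \<subseteq> U"
    by (meson open_contains_ball)
  then show "\<exists>V. open V \<and> (\<forall>x\<in>V. \<forall>y\<in>V. \<forall>u\<ge>0. \<forall>v\<ge>0. u + v = 1 \<longrightarrow> u *\<^sub>R x + v *\<^sub>R y \<in> V) \<and>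
      0 \<in> V \<and> V \<subseteq> U"
    unfolding convex_def[symmetric] by (intro exI[of _ "ball 0 e"]) auto
qed

definition dual :: "('a::locally_convex_space \<Rightarrow> real) set" where
  "dual = {p. linear p \<and> continuous_on UNIV p}"

text \<open>The coarsest topology on the dual that makes every evaluation \<open>p \<mapsto> p x\<close> continuous.\<close>

definition weak_star :: "('a::locally_convex_space \<Rightarrow> real) topology" where
  "weak_star = topology_generated_by {{p \<in> dual. p x \<in> U} | x U. open U}"

lemma topspace_weak_star: "topspace weak_star = dual"
  unfolding weak_star_def topology_generated_by_topspace by blast

definition has_weak_star_adjoint :: "('a::locally_convex_space \<Rightarrow> 'a) \<Rightarrow> bool" where
  "has_weak_star_adjoint A \<longleftrightarrow>
    (\<exists>A'. (\<forall>p\<in>dual. A' p \<in> dual \<and> (\<forall>x. A' p x = p (A x))) \<and>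
      continuous_map weak_star weak_star A')"

definition proper_fun :: "('a \<Rightarrow> ereal) \<Rightarrow> bool" where
  "proper_fun f \<longleftrightarrow> (\<forall>x. f x \<noteq> -\<infinity>) \<and> (\<exists>x. f x \<noteq> \<infinity>)"

text \<open>Only applied to functions that never take the value \<open>-\<infinity>\<close>, so that the right-hand side
  is never a sum of opposite infinities.\<close>

definition convex_fun :: "('a::real_vector \<Rightarrow> ereal) \<Rightarrow> bool" where
  "convex_fun f \<longleftrightarrow>
    (\<forall>x y t. 0 < t \<and> t < 1 \<longrightarrow>
      f ((1 - t) *\<^sub>R x + t *\<^sub>R y) \<le> ereal (1 - t) * f x + ereal t * f y)"

definition lsc_fun :: "('a::topological_space \<Rightarrow> ereal) \<Rightarrow> bool" where
  "lsc_fun f \<longleftrightarrow> (\<forall>a. open {x. a < f x})"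

definition proper_convex_lsc :: "('a::locally_convex_space \<Rightarrow> ereal) set" where
  "proper_convex_lsc = {f. proper_fun f \<and> convex_fun f \<and> lsc_fun f}"

text \<open>Maps between function classes are total in HOL; everything is relativised to \<open>G\<close>, and
  values outside \<open>G\<close> are irrelevant.\<close>

definition order_isomorphism_on :: "'b::order set \<Rightarrow> ('b \<Rightarrow> 'b) \<Rightarrow> bool" where
  "order_isomorphism_on G J \<longleftrightarrow>
    bij_betw J G G \<and> (\<forall>f\<in>G. \<forall>h\<in>G. f \<ge> h \<longleftrightarrow> J f \<ge> J h)"

definition affine_form ::
  "(('a::locally_convex_space \<Rightarrow> ereal) \<Rightarrow> ('a \<Rightarrow> ereal)) \<Rightarrow> bool" where
  "affine_form J \<longleftrightarrow>
    (\<exists>A B c b d \<delta>.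
      linear A \<and> has_weak_star_adjoint A \<and>
      linear B \<and> has_weak_star_adjoint B \<and> A \<circ> B = id \<and> B \<circ> A = id \<and>
      b \<in> dual \<and> d > 0 \<and>
      (\<forall>f\<in>proper_convex_lsc. \<forall>x.
        J f x = ereal (b x) + ereal \<delta> + ereal d * f (A x + c)))"

end

theory Submission
  imports Defs
begin

text \<open>The functions that are finite at exactly one point \<open>x\<close>, with value \<open>r\<close>, are the elements
  whose upper set is a chain, so an order isomorphism \<open>J\<close> permutes them, say
  \<open>(x, r) \<mapsto> (\<phi> x, g x r)\<close>, and \<open>f x \<le> r \<longleftrightarrow> J f (\<phi> x) \<le> g x r\<close>. Since \<open>J\<close> preserves infima, the map
  \<open>(x, r) \<mapsto> (\<phi> x, g x r)\<close> sends non-vertical segments to segments. For a fixed segment of base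
  points this is a Pexider equation in the heights, which forces the increasing functions \<open>g x\<close> to
  be affine, and it makes the reciprocal of the slope of \<open>g x\<close> an affine function of \<open>x\<close>. A positive
  affine function on a vector space is constant; with constant slope, \<open>\<phi>\<close> and \<open>x \<mapsto> g x 0\<close> preserve
  convex combinations. The continuity statements come from applying \<open>J\<close> and its inverse to
  functionals in the dual.

  For the converse, \<open>A\<close> is only weakly continuous, so that lower semicontinuity of
  \<open>x \<mapsto> f (A x + c)\<close> needs the fact that closed convex sets are weakly closed, that is,
  Hahn-Banach separation.\<close>

section \<open>Locally convex spaces\<close>

lemma tendsto_scaleR_lcs:
  fixes g :: "'b \<Rightarrow> 'a::locally_convex_space"
  assumes "(f \<longlongrightarrow> r) F" "(g \<longlongrightarrow> x) F"
  shows "((\<lambda>z. f z *\<^sub>R g z) \<longlongrightarrow> r *\<^sub>R x) F"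
  using filterlim_compose[OF tendsto_scaleR_Pair filterlim_Pair[OF assms]] by simp

lemma continuous_on_scaleR_lcs:
  fixes g :: "'b::topological_space \<Rightarrow> 'a::locally_convex_space"
  assumes "continuous_on S f" "continuous_on S g"
  shows "continuous_on S (\<lambda>z. f z *\<^sub>R g z)"
  using assms by (auto simp: continuous_on_def intro: tendsto_scaleR_lcs)

text \<open>\<open>t *\<^sub>R x\<close> tends to \<open>0\<close> as \<open>t\<close> decreases to
  \<open>0\<close>, so it eventually lies in \<open>V\<close>.\<close>

lemma absorbing_nhds_zero:
  fixes V :: "'a::locally_convex_space set"
  assumes "open V" "0 \<in> V"
  obtains t where "t > 0" "t *\<^sub>R x \<in> V"
proof -
  have "((\<lambda>t. t *\<^sub>R x) \<longlongrightarrow> 0 *\<^sub>R x) (at_right (0::real))"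
    by (intro tendsto_scaleR_lcs tendsto_const tendsto_ident_at)
  then have "\<forall>\<^sub>F t in at_right (0::real). t *\<^sub>R x \<in> V"
    using assms by (auto simp: tendsto_def)
  then have "\<forall>\<^sub>F t in at_right (0::real). t *\<^sub>R x \<in> V \<and> t > 0"
    using eventually_at_right_less[of "0::real"] by (auto elim: eventually_elim2)
  then show ?thesis
    using that eventually_happens[of _ "at_right (0::real)"] by auto
qed

text \<open>Lower semicontinuity is one half of continuity, and \<open>l (- x) = - l x\<close> turns
  it into the other half. Membership in \<open>proper_convex_lsc\<close> provides only the first
  half.\<close>

lemma linear_lsc_imp_dual:
  fixes l :: "'a::locally_convex_space \<Rightarrow> real"
  assumes l: "linear l" and lsc: "\<And>a. open {x. a < l x}"
  shows "l \<in> dual"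
proof -
  have *: "open {x. l x < a}" for a
  proof -
    have "{x. l x < a} = uminus -` {x. - a < l x}"
      using linear_neg[OF l] by auto
    moreover have "open (uminus -` {x. - a < l x})"
      by (intro open_vimage lsc continuous_on_minus continuous_on_id)
    ultimately show ?thesis by simp
  qed
  have "(l \<longlongrightarrow> l x) (at x)" for x
  proof (rule order_tendstoI)
    fix a assume "a < l x"
    then show "\<forall>\<^sub>F z in at x. a < l z"
      using topological_tendstoD[OF tendsto_ident_at lsc[of a], of x UNIV] by simp
  next
    fix a assume "l x < a"
    then show "\<forall>\<^sub>F z in at x. l z < a"
      using topological_tendstoD[OF tendsto_ident_at *[of a], of x UNIV] by simp
  qed
  then show ?thesis
    using l by (auto simp: dual_def continuous_on_def)
qed

lemma linear_bounded_above_imp_dual: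
  fixes l :: "'a::locally_convex_space \<Rightarrow> real"
  assumes l: "linear l" and V: "open V" "0 \<in> V" and le: "\<And>v. v \<in> V \<Longrightarrow> l v \<le> 1"
  shows "l \<in> dual"
proof (rule linear_lsc_imp_dual[OF l])
  fix a
  show "open {x. a < l x}"
  proof (subst open_subopen, safe)
    fix x assume x: "a < l x"
    \<comment> \<open>With this \<open>k\<close>, the bound \<open>k * (l x - l z) \<le> 1\<close>
      keeps \<open>l z\<close> at or above the midpoint of \<open>a\<close> and
      \<open>l x\<close>.\<close>
    define k where "k = 2 / (l x - a)"
    have k: "k > 0" using x by (simp add: k_def)
    let ?W = "(\<lambda>z. k *\<^sub>R (x - z)) -` V"
    have "open ?W"
      by (intro open_vimage V continuous_on_scaleR_lcs continuous_intros)
    moreover have "x \<in> ?W" using V by simp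
    moreover have "?W \<subseteq> {x. a < l x}"
    proof safe
      fix z assume "k *\<^sub>R (x - z) \<in> V"
      then have "k * (l x - l z) \<le> 1"
        using le[of "k *\<^sub>R (x - z)"] by (simp add: linear_cmul[OF l] linear_diff[OF l])
      then show "a < l z" using x by (simp add: k_def field_simps)
    qed
    ultimately show "\<exists>T. open T \<and> x \<in> T \<and> T \<subseteq> {x. a < l x}" by blast
  qed
qed

text \<open>The adjoint is composition with \<open>A\<close>. It pulls evaluation at
  \<open>x\<close> back to evaluation at \<open>A x\<close>, so weak-star continuity is automatic
  once \<open>dual\<close> is preserved.\<close>

lemma has_weak_star_adjointI:
  assumes "\<And>p. p \<in> dual \<Longrightarrow> (\<lambda>x. p (A x)) \<in> dual"
  shows "has_weak_star_adjoint A"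
  unfolding has_weak_star_adjoint_def
proof (intro exI[of _ "\<lambda>p x. p (A x)"] conjI ballI allI refl assms)
  show "continuous_map weak_star weak_star (\<lambda>p x. p (A x))"
    unfolding weak_star_def
  proof (rule continuous_on_generated_topo, fold weak_star_def)
    fix W :: "('a \<Rightarrow> real) set"
    assume "W \<in> {{p \<in> dual. p x \<in> U} |x U. open U}"
    then obtain x U where W: "W = {p \<in> dual. p x \<in> U}" "open U" by blast
    then have "(\<lambda>p x. p (A x)) -` W \<inter> topspace weak_star = {p \<in> dual. p (A x) \<in> U}"
      using assms by (auto simp: topspace_weak_star)
    moreover have "openin weak_star {p \<in> dual. p (A x) \<in> U}"
      unfolding weak_star_def using W(2) by (intro topology_generated_by_Basis) blast
    ultimately show "openin weak_star ((\<lambda>p x. p (A x)) -` W \<inter> topspace weak_star)" by simp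
  next
    have "\<Union> {{p \<in> dual. p x \<in> U} |x U. open U} = (dual :: ('a \<Rightarrow> real) set)"
      by blast
    then show "(\<lambda>p x. p (A x)) ` topspace weak_star \<subseteq> \<Union> {{p \<in> dual. p x \<in> U} |x U. open U}"
      using assms by (auto simp: topspace_weak_star)
  qed
qed

lemma has_weak_star_adjointD:
  assumes "has_weak_star_adjoint A" "p \<in> dual"
  shows "(\<lambda>x. p (A x)) \<in> dual"
proof -
  obtain A' where "A' p \<in> dual" "\<And>x. A' p x = p (A x)"
    using assms unfolding has_weak_star_adjoint_def by blast
  then show ?thesis by (metis (no_types, lifting) ext)
qed

section \<open>Hahn-Banach separation\<close>

definition sublinear :: "('a::real_vector \<Rightarrow> real) \<Rightarrow> bool" where
  "sublinear q \<longleftrightarrow> (\<forall>x y. q (x + y) \<le> q x + q y) \<and> (\<forall>x. \<forall>t\<ge>0. q (t *\<^sub>R x) = t * q x)"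

text \<open>The inequality for \<open>t\<close> and the one for \<open>inverse t\<close> together
  give equality, so homogeneity needs only one direction.\<close>

lemma sublinearI:
  fixes q :: "'a::real_vector \<Rightarrow> real"
  assumes add: "\<And>x y. q (x + y) \<le> q x + q y" and zero: "q 0 = 0"
    and le: "\<And>x t. t > 0 \<Longrightarrow> q (t *\<^sub>R x) \<le> t * q x"
  shows "sublinear q"
proof -
  have "q (t *\<^sub>R x) = t * q x" if t: "t > 0" for t x
  proof (rule antisym)
    have "q (inverse t *\<^sub>R t *\<^sub>R x) \<le> inverse t * q (t *\<^sub>R x)" using t by (intro le) simp
    then show "t * q x \<le> q (t *\<^sub>R x)" using t by (simp add: field_simps)
  qed (use le t in simp)
  then have "q (t *\<^sub>R x) = t * q x" if "t \<ge> 0" for t x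
    using that zero by (cases "t = 0") auto
  then show ?thesis using add by (simp add: sublinear_def)
qed

lemma sublinear_add: "sublinear q \<Longrightarrow> q (x + y) \<le> q x + q y"
  and sublinear_scaleR: "sublinear q \<Longrightarrow> t \<ge> 0 \<Longrightarrow> q (t *\<^sub>R x) = t * q x"
  by (auto simp: sublinear_def)

lemma sublinear_zero: "sublinear q \<Longrightarrow> q 0 = 0"
  using sublinear_scaleR[of q 0 0] by simp

lemma sublinear_uminus: "sublinear q \<Longrightarrow> - q (- x) \<le> q x"
  using sublinear_add[of q x "- x"] sublinear_zero[of q] by simp

text \<open>Lowering \<open>q\<close> at \<open>- y\<close> serves twice: it makes minimal
  functionals odd, and it makes Hahn-Banach exact at a prescribed point.\<close>

lemma sublinear_lower_at:
  assumes q: "sublinear q"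
  obtains q' where "sublinear q'" "q' \<le> q" "q' (- y) \<le> - q y"
proof -
  \<comment> \<open>\<open>t = 0\<close> gives \<open>q' \<le> q\<close>, and \<open>t = 1\<close>
    gives the bound at \<open>- y\<close>; \<open>lb\<close> keeps the infimum finite.\<close>
  define q' where "q' x = (INF t\<in>{0..}. q (x + t *\<^sub>R y) - t * q y)" for x
  have lb: "- q (- x) \<le> q (x + t *\<^sub>R y) - t * q y" if "t \<ge> 0" for x t
    using sublinear_add[OF q, of "x + t *\<^sub>R y" "- x"] sublinear_scaleR[OF q that, of y] by simp
  have bdd: "bdd_below ((\<lambda>t. q (x + t *\<^sub>R y) - t * q y) ` {0..})" for x
    using lb by (intro bdd_belowI2) auto
  have upper: "q' x \<le> q (x + t *\<^sub>R y) - t * q y" if "t \<ge> 0" for x t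
    unfolding q'_def using that by (intro cINF_lower bdd) auto
  have lower: "m \<le> q' x" if "\<And>t. t \<ge> 0 \<Longrightarrow> m \<le> q (x + t *\<^sub>R y) - t * q y" for m x
    unfolding q'_def using that by (intro cINF_greatest) auto
  show ?thesis
  proof
    show "sublinear q'"
    proof (rule sublinearI)
      fix x z
      have "q' (x + z) - (q (z + s *\<^sub>R y) - s * q y) \<le> q (x + t *\<^sub>R y) - t * q y"
        if "t \<ge> 0" "s \<ge> 0" for t s
        using upper[of "t + s" "x + z"] that
          sublinear_add[OF q, of "x + t *\<^sub>R y" "z + s *\<^sub>R y"]
        by (simp add: algebra_simps)
      \<comment> \<open>The two infima are taken one after the other: over \<open>t\<close> with
        \<open>s\<close> fixed, then, after rearranging, over \<open>s\<close>.\<close>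
      then have "q' (x + z) - (q (z + s *\<^sub>R y) - s * q y) \<le> q' x" if "s \<ge> 0" for s
        using that by (intro lower) auto
      then have "q' (x + z) - q' x \<le> q (z + s *\<^sub>R y) - s * q y" if "s \<ge> 0" for s
        using that by (smt (verit))
      then have "q' (x + z) - q' x \<le> q' z" by (intro lower)
      then show "q' (x + z) \<le> q' x + q' z" by simp
    next
      show "q' 0 = 0"
        using upper[of 0 0] lower[of 0 0] sublinear_scaleR[OF q, of _ y] sublinear_zero[OF q]
        by (intro antisym) auto
    next
      fix x and t :: real assume t: "t > 0"
      have "q' (t *\<^sub>R x) / t \<le> q (x + s *\<^sub>R y) - s * q y" if "s \<ge> 0" for s
        using upper[of "t * s" "t *\<^sub>R x"] sublinear_scaleR[OF q, of t "x + s *\<^sub>R y"] t that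
        by (simp add: field_simps scaleR_add_right)
      then have "q' (t *\<^sub>R x) / t \<le> q' x" by (intro lower)
      then show "q' (t *\<^sub>R x) \<le> t * q' x" using t by (simp add: field_simps)
    qed
    show "q' \<le> q" using upper[of 0] by (auto simp: le_fun_def)
    show "q' (- y) \<le> - q y" using upper[of 1 "- y"] sublinear_zero[OF q] by simp
  qed
qed

text \<open>Instead of extending linear functionals from subspaces, shrink the sublinear functional: a
  minimal one is linear.\<close>

lemma minimal_sublinear_linear:
  assumes q: "sublinear q" and min: "\<And>q'. sublinear q' \<Longrightarrow> q' \<le> q \<Longrightarrow> q' = q"
  shows "linear q"
proof -
  have neg: "q (- y) = - q y" for y
  proof -
    obtain q' where "sublinear q'" "q' \<le> q" "q' (- y) \<le> - q y"
      using sublinear_lower_at[OF q] .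
    then show ?thesis using min[of q'] sublinear_uminus[OF q, of "- y"] by auto
  qed
  show ?thesis
  proof (rule linearI)
    fix x y
    show "q (x + y) = q x + q y"
      using sublinear_add[OF q, of x y] sublinear_add[OF q, of "- x" "- y"]
        neg[of "x + y"] neg[of x] neg[of y] by simp
  next
    fix t x
    show "q (t *\<^sub>R x) = t *\<^sub>R q x"
    proof (cases "t \<ge> 0")
      case False
      then show ?thesis
        using sublinear_scaleR[OF q, of "- t" x] neg[of "t *\<^sub>R x"] by simp
    qed (simp add: sublinear_scaleR[OF q])
  qed
qed

text \<open>Supplies the lower bounds for Zorn's lemma. The bound \<open>p\<close> keeps the
  pointwise infimum finite; subadditivity holds because two members of the chain can be replaced by
  the smaller one.\<close>

lemma sublinear_chain_Inf:
  fixes p :: "'a::real_vector \<Rightarrow> real"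
  assumes C: "C \<noteq> {}" "\<And>q. q \<in> C \<Longrightarrow> sublinear q \<and> q \<le> p"
    and chain: "\<And>q q'. q \<in> C \<Longrightarrow> q' \<in> C \<Longrightarrow> q \<le> q' \<or> q' \<le> q"
  obtains m where "sublinear m" "\<And>q. q \<in> C \<Longrightarrow> m \<le> q"
proof -
  define m where "m x = (INF q\<in>C. q x)" for x
  have bdd: "bdd_below ((\<lambda>q. q x) ` C)" for x
  proof (rule bdd_belowI2)
    fix q assume "q \<in> C"
    then have "q (- x) \<le> p (- x)" "- q (- x) \<le> q x"
      using C(2)[of q] sublinear_uminus[of q x] by (auto simp: le_fun_def)
    then show "- p (- x) \<le> q x" by linarith
  qed
  have upper: "m x \<le> q x" if "q \<in> C" for q x
    unfolding m_def by (rule cINF_lower[OF bdd that])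
  have lower: "k \<le> m x" if "\<And>q. q \<in> C \<Longrightarrow> k \<le> q x" for k x
    unfolding m_def using that by (rule cINF_greatest[OF C(1)])
  show ?thesis
  proof
    show "sublinear m"
    proof (rule sublinearI)
      fix x y
      have "m (x + y) - v y \<le> u x" if uv: "u \<in> C" "v \<in> C" for u v
      proof -
        obtain w where w: "w \<in> C" "w \<le> u" "w \<le> v" using chain[OF uv] uv by blast
        then have "w x \<le> u x" "w y \<le> v y" by (auto simp: le_fun_def)
        moreover have "m (x + y) \<le> w x + w y"
          using upper[OF w(1), of "x + y"] sublinear_add[of w x y] C(2)[OF w(1)] by simp
        ultimately show ?thesis by linarith
      qed
      then have "m (x + y) - v y \<le> m x" if "v \<in> C" for v using that by (intro lower) auto
      then have "m (x + y) - m x \<le> v y" if "v \<in> C" for v using that by (smt (verit))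
      then have "m (x + y) - m x \<le> m y" by (intro lower)
      then show "m (x + y) \<le> m x + m y" by simp
    next
      have "(\<lambda>q. q 0) ` C = {0}" using C sublinear_zero by force
      then show "m 0 = 0" by (simp add: m_def)
    next
      fix x and t :: real assume t: "t > 0"
      have "m (t *\<^sub>R x) / t \<le> q x" if "q \<in> C" for q
        using upper[OF that, of "t *\<^sub>R x"] sublinear_scaleR[of q t x] C(2)[OF that] t
        by (simp add: field_simps)
      then have "m (t *\<^sub>R x) / t \<le> m x" by (intro lower)
      then show "m (t *\<^sub>R x) \<le> t * m x" using t by (simp add: field_simps)
    qed
    show "m \<le> q" if "q \<in> C" for q using upper[OF that] by (simp add: le_fun_def)
  qed
qed

lemma sublinear_dominates_linear:
  fixes p :: "'a::real_vector \<Rightarrow> real"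
  assumes p: "sublinear p"
  obtains l where "linear l" "l \<le> p"
proof -
  define S where "S = {q. sublinear q \<and> q \<le> p}"
  have "\<exists>m\<in>S. \<forall>a\<in>S. a \<le> m \<longrightarrow> a = m"
  proof (rule predicate_Zorn)
    \<comment> \<open>The order is reversed, so that a maximal element is a minimal
      functional.\<close>
    show "partial_order_on S (relation_of (\<lambda>x y. y \<le> x) S)"
      by (rule partial_order_on_relation_ofI) auto
  next
    fix C assume C: "C \<in> Chains (relation_of (\<lambda>x y. y \<le> x) S)"
    then have CS: "C \<subseteq> S" by (rule Chains_relation_of)
    show "\<exists>u\<in>S. \<forall>a\<in>C. u \<le> a"
    proof (cases "C = {}")
      case True
      then show ?thesis using p by (auto simp: S_def)
    next
      case False
      have "q \<le> q' \<or> q' \<le> q" if "q \<in> C" "q' \<in> C" for q q'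
        using C that by (auto simp: Chains_def relation_of_def)
      moreover have "sublinear q \<and> q \<le> p" if "q \<in> C" for q using CS that by (auto simp: S_def)
      ultimately obtain m where m: "sublinear m" "\<And>q. q \<in> C \<Longrightarrow> m \<le> q"
        using sublinear_chain_Inf[OF False] by metis
      obtain q where "q \<in> C" using False by blast
      then have "m \<le> q" "q \<le> p" using m(2) CS by (auto simp: S_def)
      then have "m \<le> p" by (rule order_trans)
      then show ?thesis using m by (auto simp: S_def)
    qed
  qed
  then obtain l where "l \<in> S" "\<And>q. q \<in> S \<Longrightarrow> q \<le> l \<Longrightarrow> q = l" by blast
  then have "linear l" "l \<le> p"
    using minimal_sublinear_linear[of l] order_trans[of _ l p] unfolding S_def by blast+
  then show ?thesis using that by blast
qed

text \<open>Lower \<open>p\<close> at \<open>- x\<close> first: any linear \<open>l\<close> below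
  the result satisfies \<open>l (- x) \<le> - p x\<close>, that is,
  \<open>p x \<le> l x\<close>.\<close>

lemma Hahn_Banach_sublinear:
  fixes p :: "'a::real_vector \<Rightarrow> real"
  assumes "sublinear p"
  obtains l where "linear l" "l \<le> p" "l x = p x"
proof -
  obtain q where q: "sublinear q" "q \<le> p" "q (- x) \<le> - p x"
    using sublinear_lower_at[OF assms] .
  obtain l where l: "linear l" "l \<le> q" using sublinear_dominates_linear[OF q(1)] .
  have "l \<le> p" using l(2) q(2) by simp
  moreover have "l (- x) \<le> q (- x)" "l x \<le> p x" using l(2) \<open>l \<le> p\<close> by (auto simp: le_fun_def)
  ultimately show ?thesis using that[OF l(1)] q(3) linear_neg[OF l(1), of x] by simp
qed

section \<open>Minkowski gauge and separation from closed convex sets\<close>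

definition minkowski_gauge :: "'a::real_vector set \<Rightarrow> 'a \<Rightarrow> real" where
  "minkowski_gauge K x = Inf {t. t > 0 \<and> inverse t *\<^sub>R x \<in> K}"

lemma minkowski_gauge_le: "t > 0 \<Longrightarrow> inverse t *\<^sub>R x \<in> K \<Longrightarrow> minkowski_gauge K x \<le> t"
  unfolding minkowski_gauge_def by (intro cInf_lower bdd_belowI[of _ 0]) auto

lemma minkowski_gauge_ge:
  assumes "\<exists>t>0. inverse t *\<^sub>R x \<in> K" "\<And>t. t > 0 \<Longrightarrow> inverse t *\<^sub>R x \<in> K \<Longrightarrow> m \<le> t"
  shows "m \<le> minkowski_gauge K x"
  unfolding minkowski_gauge_def using assms by (intro cInf_greatest) auto

lemma sublinear_minkowski_gauge:
  fixes K :: "'a::real_vector set"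
  assumes K: "convex K" "0 \<in> K" and abs: "\<And>x. \<exists>t>0. inverse t *\<^sub>R x \<in> K"
  shows "sublinear (minkowski_gauge K)"
proof (rule sublinearI)
  let ?q = "minkowski_gauge K"
  fix x y
  have "?q (x + y) - s \<le> t"
    if "t > 0" "inverse t *\<^sub>R x \<in> K" "s > 0" "inverse s *\<^sub>R y \<in> K" for t s
  proof -
    \<comment> \<open>These weights sum to \<open>1\<close> and turn the two scaled vectors into a
      multiple of \<open>x + y\<close>.\<close>
    have "(t / (t + s)) *\<^sub>R (inverse t *\<^sub>R x) + (s / (t + s)) *\<^sub>R (inverse s *\<^sub>R y) \<in> K"
      using that by (intro convexD[OF K(1)]) (auto simp: add_divide_distrib[symmetric])
    moreover have "(t / (t + s)) *\<^sub>R (inverse t *\<^sub>R x) + (s / (t + s)) *\<^sub>R (inverse s *\<^sub>R y)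
        = inverse (t + s) *\<^sub>R (x + y)"
      using that by (simp add: scaleR_add_right field_simps)
    ultimately show ?thesis using minkowski_gauge_le[of "t + s" "x + y" K] that by simp
  qed
  then have "?q (x + y) - s \<le> ?q x" if "s > 0" "inverse s *\<^sub>R y \<in> K" for s
    using that abs by (intro minkowski_gauge_ge) auto
  then have "?q (x + y) - ?q x \<le> s" if "s > 0" "inverse s *\<^sub>R y \<in> K" for s
    using that by (smt (verit))
  then have "?q (x + y) - ?q x \<le> ?q y"
    using abs by (intro minkowski_gauge_ge) auto
  then show "?q (x + y) \<le> ?q x + ?q y" by simp
next
  show "minkowski_gauge K 0 = 0"
  proof (rule antisym)
    show "minkowski_gauge K 0 \<le> 0"
    proof (rule field_le_epsilon)
      fix e :: real assume "e > 0"
      then show "minkowski_gauge K 0 \<le> 0 + e" using minkowski_gauge_le[of e 0 K] K(2) by simp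
    qed
    show "0 \<le> minkowski_gauge K 0"
      by (rule minkowski_gauge_ge[OF abs]) simp
  qed
next
  fix x and t :: real assume t: "t > 0"
  have "minkowski_gauge K (t *\<^sub>R x) / t \<le> minkowski_gauge K x"
  proof (rule minkowski_gauge_ge[OF abs])
    fix s assume s: "s > 0" "inverse s *\<^sub>R x \<in> K"
    then have "minkowski_gauge K (t *\<^sub>R x) \<le> t * s"
      using t minkowski_gauge_le[of "t * s" "t *\<^sub>R x" K] by (simp add: field_simps)
    then show "minkowski_gauge K (t *\<^sub>R x) / t \<le> s"
      using t by (simp add: pos_divide_le_eq mult.commute)
  qed
  then show "minkowski_gauge K (t *\<^sub>R x) \<le> t * minkowski_gauge K x"
    using t by (simp add: field_simps)
qed

lemma closed_convex_separation:
  fixes C :: "'a::locally_convex_space set"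
  assumes C: "closed C" "convex C" and x: "x \<notin> C"
  obtains p a where "p \<in> dual" "a < p x" "\<And>c. c \<in> C \<Longrightarrow> p c \<le> a"
proof (cases "C = {}")
  case True
  have "(\<lambda>x. 0) \<in> dual" by (simp add: dual_def linear_zero)
  then show ?thesis using True by (intro that[of "\<lambda>x. 0" "-1"]) auto
next
  case False
  then obtain c0 where c0: "c0 \<in> C" by blast
  have "open ((\<lambda>v. x + v) -` (- C))"
    using C(1) by (intro open_vimage continuous_intros) auto
  then obtain V where V: "open V" "convex V" "0 \<in> V" "V \<subseteq> (\<lambda>v. x + v) -` (- C)"
    using convex_nhds_zero[of "(\<lambda>v. x + v) -` (- C)"] x by auto
  \<comment> \<open>\<open>K\<close> is \<open>C - c0 - V\<close>, a convex neighbourhood of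
    \<open>0\<close>. It misses \<open>x - c0\<close> because \<open>x + V\<close> misses
    \<open>C\<close>.\<close>
  define K where "K = {k. \<exists>c\<in>C. c - c0 - k \<in> V}"
  have "convex K"
  proof (rule convexI)
    fix k k' and u v :: real
    assume "k \<in> K" "k' \<in> K" and uv: "0 \<le> u" "0 \<le> v" "u + v = 1"
    then obtain c c' where c: "c \<in> C" "c - c0 - k \<in> V" "c' \<in> C" "c' - c0 - k' \<in> V"
      by (auto simp: K_def)
    have "u *\<^sub>R c + v *\<^sub>R c' \<in> C" using C(2) c uv by (auto intro: convexD)
    moreover have "u *\<^sub>R (c - c0 - k) + v *\<^sub>R (c' - c0 - k') \<in> V"
      using V(2) c uv by (auto intro: convexD)
    moreover have "u *\<^sub>R (c - c0 - k) + v *\<^sub>R (c' - c0 - k')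
        = u *\<^sub>R c + v *\<^sub>R c' - (u + v) *\<^sub>R c0 - (u *\<^sub>R k + v *\<^sub>R k')"
      by (simp add: algebra_simps)
    ultimately show "u *\<^sub>R k + v *\<^sub>R k' \<in> K" using uv by (auto simp: K_def)
  qed
  have VK: "- v \<in> K" if "v \<in> V" for v using c0 that unfolding K_def by force
  have "0 \<in> K" using VK[OF V(3)] by simp
  have absK: "\<exists>t>0. inverse t *\<^sub>R y \<in> K" for y
  proof -
    obtain t where "t > 0" "t *\<^sub>R (- y) \<in> V" using absorbing_nhds_zero[OF V(1,3)] .
    then show ?thesis using VK[of "t *\<^sub>R (- y)"] by (intro exI[of _ "inverse t"]) auto
  qed
  \<comment> \<open>This \<open>l\<close> is at most \<open>1\<close> on \<open>K\<close> and at
    least \<open>1\<close> at \<open>x - c0\<close>, which lies outside \<open>K\<close>.\<close>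
  obtain l where l: "linear l" "l \<le> minkowski_gauge K"
    "l (x - c0) = minkowski_gauge K (x - c0)"
    using Hahn_Banach_sublinear[OF sublinear_minkowski_gauge[OF \<open>convex K\<close> \<open>0 \<in> K\<close> absK]] .
  have "x - c0 \<notin> K" using V(4) by (fastforce simp: K_def)
  have "1 \<le> minkowski_gauge K (x - c0)"
  proof (rule minkowski_gauge_ge[OF absK], rule ccontr)
    fix t :: real assume t: "t > 0" "inverse t *\<^sub>R (x - c0) \<in> K" "\<not> 1 \<le> t"
    then have "t *\<^sub>R (inverse t *\<^sub>R (x - c0)) + (1 - t) *\<^sub>R 0 \<in> K"
      using \<open>convex K\<close> \<open>0 \<in> K\<close> by (intro convexD) auto
    then show False using t \<open>x - c0 \<notin> K\<close> by simp
  qed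
  have le1: "l k \<le> 1" if "k \<in> K" for k
    using order_trans[OF le_funD[OF l(2), of k] minkowski_gauge_le[of 1 k K]] that by simp
  have nonneg: "1 \<le> l (x - c0)" using l(3) \<open>1 \<le> minkowski_gauge K (x - c0)\<close> by simp
  have "l \<in> dual"
  proof (rule linear_bounded_above_imp_dual[OF l(1)])
    show "open (uminus -` V)"
      by (intro open_vimage V continuous_intros)
    show "0 \<in> uminus -` V" using V by simp
    show "l v \<le> 1" if "v \<in> uminus -` V" for v using le1[OF VK[of "- v"]] that by simp
  qed
  \<comment> \<open>The comparison on \<open>K\<close> alone would give only
    \<open>l c \<le> l x\<close> up to \<open>V\<close>; moving by a fixed vector of
    \<open>V\<close> with negative \<open>l\<close>-value gives a gap uniform in
    \<open>c\<close>.\<close>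
  obtain t where t: "t > 0" "t *\<^sub>R (c0 - x) \<in> V" using absorbing_nhds_zero[OF V(1,3)] .
  have "l c \<le> l x + l (t *\<^sub>R (c0 - x))" if "c \<in> C" for c
  proof -
    have "c - c0 - t *\<^sub>R (c0 - x) \<in> K" using that t unfolding K_def by force
    from le1[OF this] show ?thesis using nonneg by (simp add: linear_diff[OF l(1)])
  qed
  moreover have "l (t *\<^sub>R (c0 - x)) < 0"
    using t nonneg by (simp add: linear_cmul[OF l(1)] linear_diff[OF l(1)] mult_pos_neg)
  ultimately show ?thesis using \<open>l \<in> dual\<close> by (intro that[of l "l x + l (t *\<^sub>R (c0 - x))"]) auto
qed

text \<open>\<open>A\<close> need not be continuous for the given topology, only for the weak one; convex sets do
  not see the difference.\<close>

lemma closed_affine_vimage: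
  fixes A :: "'a::locally_convex_space \<Rightarrow> 'a"
  assumes A: "has_weak_star_adjoint A" and C: "closed C" "convex C"
  shows "closed {x. A x + c \<in> C}"
proof -
  have "open {x. A x + c \<notin> C}"
  proof (subst open_subopen, safe)
    fix x assume "A x + c \<notin> C"
    then obtain p a where p: "p \<in> dual" "a < p (A x + c)" "\<And>y. y \<in> C \<Longrightarrow> p y \<le> a"
      using closed_convex_separation[OF C] by metis
    \<comment> \<open>The preimage of an open half-space that misses \<open>C\<close>; it is open
      because \<open>p\<close> composed with \<open>A\<close> lies in \<open>dual\<close>.\<close>
    let ?W = "{z. a < p (A z + c)}"
    have add: "p (A z + c) = p (A z) + p c" for z using p(1) by (simp add: dual_def linear_add)
    have "continuous_on UNIV (\<lambda>z. p (A z))"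
      using has_weak_star_adjointD[OF A p(1)] by (simp add: dual_def)
    then have "open ?W" unfolding add by (intro open_Collect_less continuous_intros)
    then show "\<exists>T. open T \<and> x \<in> T \<and> T \<subseteq> {x. A x + c \<notin> C}" using p(2,3) by fastforce
  qed
  then show ?thesis by (simp add: closed_def Compl_eq)
qed

section \<open>Real affine maps\<close>

text \<open>Additivity settles integer multiples. Monotonicity squeezes \<open>k (n * x)\<close>
  between neighbouring integers, with an error of at most \<open>k 1\<close> for every
  \<open>n\<close>, and dividing by \<open>n\<close> removes it.\<close>

lemma additive_mono_real:
  fixes k :: "real \<Rightarrow> real"
  assumes add: "\<And>x y. k (x + y) = k x + k y" and mono: "mono k"
  shows "k x = x * k 1"
proof -
  have k0: "k 0 = 0" using add[of 0 0] by simp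
  have neg: "k (- x) = - k x" for x using add[of x "- x"] k0 by simp
  have kn: "k (real n * x) = real n * k x" for n x
    by (induction n) (simp_all add: k0 add distrib_right)
  have ki: "k (of_int i * x) = of_int i * k x" for i x
  proof (cases i rule: int_cases2)
    case (nonneg n)
    then show ?thesis using kn[of n x] by simp
  next
    case (nonpos n)
    then show ?thesis using kn[of n x] neg[of "real n * x"] by simp
  qed
  have k1: "0 \<le> k 1" using monoD[OF mono, of 0 1] k0 by simp
  have le: "real n * \<bar>k x - x * k 1\<bar> \<le> k 1" for n
  proof -
    let ?i = "\<lfloor>real n * x\<rfloor>"
    have "k (of_int ?i) \<le> k (real n * x)" "k (real n * x) \<le> k (of_int (?i + 1))"
      by (intro monoD[OF mono]; linarith)+
    then have "of_int ?i * k 1 \<le> real n * k x" "real n * k x \<le> of_int (?i + 1) * k 1"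
      using ki[of ?i 1] ki[of "?i + 1" 1] kn[of n x] by simp_all
    moreover have "of_int ?i * k 1 \<le> (real n * x) * k 1"
      "(real n * x) * k 1 \<le> of_int (?i + 1) * k 1"
      using k1 by (intro mult_right_mono; linarith)+
    ultimately have "\<bar>real n * k x - (real n * x) * k 1\<bar> \<le> k 1"
      by (simp add: abs_le_iff algebra_simps)
    then show ?thesis
      by (simp add: abs_mult right_diff_distrib[symmetric] mult.assoc)
  qed
  have "\<bar>k x - x * k 1\<bar> = 0"
  proof (rule ccontr)
    assume "\<bar>k x - x * k 1\<bar> \<noteq> 0"
    then obtain n where "k 1 < real n * \<bar>k x - x * k 1\<bar>"
      using reals_Archimedean3[of "\<bar>k x - x * k 1\<bar>"] by auto
    then show False using le[of n] by simp
  qed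
  then show ?thesis by simp
qed

text \<open>The left side depends only on \<open>r + s\<close>, so moving weight between
  \<open>r\<close> and \<open>s\<close> shows that \<open>a\<close> minus \<open>a 0\<close> is
  additive.\<close>

lemma pexider_mono_affine:
  fixes a b g :: "real \<Rightarrow> real"
  assumes eq: "\<And>r s. g (r + s) = a r + b s" and mono: "mono a"
  shows "a r = a 0 + r * (a 1 - a 0)"
proof -
  have add: "a (r + s) - a 0 = (a r - a 0) + (a s - a 0)" for r s
    using eq[of "r + s" 0] eq[of r s] eq[of 0 s] eq[of s 0] by simp
  have "mono (\<lambda>r. a r - a 0)" using mono by (simp add: mono_def)
  from additive_mono_real[OF add this, of r] show ?thesis by simp
qed

text \<open>Combinations with \<open>0\<close> give homogeneity on the unit interval, inverses
  extend it to larger factors, and doubling a midpoint gives additivity. The vector-valued form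
  covers both \<open>\<phi>\<close> and \<open>e\<close>.\<close>

lemma affine_imp_linear:
  fixes F :: "'a::real_vector \<Rightarrow> 'b::real_vector"
  assumes F: "\<And>x y t. 0 \<le> t \<Longrightarrow> t \<le> 1 \<Longrightarrow>
    F ((1 - t) *\<^sub>R x + t *\<^sub>R y) = (1 - t) *\<^sub>R F x + t *\<^sub>R F y"
  shows "linear (\<lambda>x. F x - F 0)"
proof -
  define L where "L x = F x - F 0" for x
  have small: "L (t *\<^sub>R x) = t *\<^sub>R L x" if "0 \<le> t" "t \<le> 1" for t x
    using F[OF that, of 0 x] by (simp add: L_def algebra_simps)
  have nonneg: "L (t *\<^sub>R x) = t *\<^sub>R L x" if t: "0 \<le> t" for t x
  proof (cases "t \<le> 1")
    case False
    then have "L (inverse t *\<^sub>R t *\<^sub>R x) = inverse t *\<^sub>R L (t *\<^sub>R x)"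
      by (intro small) (simp_all add: field_simps)
    then have "t *\<^sub>R L x = t *\<^sub>R inverse t *\<^sub>R L (t *\<^sub>R x)" using False by simp
    then show ?thesis using False by simp
  qed (use t small in simp)
  have add: "L (x + y) = L x + L y" for x y
  proof -
    have half: "L ((1/2) *\<^sub>R (x + y)) = (1/2) *\<^sub>R (L x + L y)"
      using F[of "1/2" x y] scaleR_add_left[of "1/2" "1/2" "F 0"]
      by (simp add: L_def algebra_simps)
    have "L (x + y) = L (2 *\<^sub>R (1/2) *\<^sub>R (x + y))" by simp
    also have "\<dots> = 2 *\<^sub>R L ((1/2) *\<^sub>R (x + y))" by (rule nonneg) simp
    also have "\<dots> = L x + L y" unfolding half by simp
    finally show ?thesis .
  qed
  have neg: "L (- x) = - L x" for x
    using add[of x "- x"] by (simp add: L_def add_eq_0_iff)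
  have "L (t *\<^sub>R x) = t *\<^sub>R L x" for t x
    using nonneg[of t x] nonneg[of "- t" x] neg[of "t *\<^sub>R x"] by (cases "t \<ge> 0") auto
  then have "linear L" by (intro linearI add)
  then show ?thesis by (simp add: L_def[abs_def])
qed

lemma positive_affine_const:
  fixes D :: "'a::real_vector \<Rightarrow> real"
  assumes D: "\<And>x y t. 0 \<le> t \<Longrightarrow> t \<le> 1 \<Longrightarrow>
      D ((1 - t) *\<^sub>R x + t *\<^sub>R y) = (1 - t) * D x + t * D y"
    and pos: "\<And>x. D x > 0"
  shows "D x = D 0"
proof -
  have lin: "linear (\<lambda>x. D x - D 0)" using D by (intro affine_imp_linear) simp
  have "\<not> D x \<noteq> D 0"
  proof
    assume ne: "D x \<noteq> D 0"
    \<comment> \<open>On the line through \<open>0\<close> and \<open>x\<close>, \<open>D\<close>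
      vanishes at \<open>k *\<^sub>R x\<close>.\<close>
    define k where "k = - D 0 / (D x - D 0)"
    have "D (k *\<^sub>R x) - D 0 = k * (D x - D 0)"
      using linear_cmul[OF lin, of k x] by simp
    also have "\<dots> = - D 0" using ne by (simp add: k_def)
    finally show False using pos[of "k *\<^sub>R x"] by simp
  qed
  then show ?thesis by simp
qed

section \<open>Segment functions and point functions\<close>

text \<open>An infinite value makes the right side infinite, so convexity has to be checked at
  finite values only.\<close>

lemma ereal_le_convex_combI:
  fixes u v w :: ereal
  assumes "\<And>r s. u = ereal r \<Longrightarrow> v = ereal s \<Longrightarrow> w \<le> ereal ((1 - t) * r + t * s)"
    and "u \<noteq> -\<infinity>" "v \<noteq> -\<infinity>" "0 < t" "t < 1"
  shows "w \<le> ereal (1 - t) * u + ereal t * v"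
  using assms by (cases u; cases v) auto

lemma convex_funD:
  assumes "f \<in> proper_convex_lsc" "f x \<le> ereal r" "f y \<le> ereal s" "0 \<le> t" "t \<le> 1"
  shows "f ((1 - t) *\<^sub>R x + t *\<^sub>R y) \<le> ereal ((1 - t) * r + t * s)"
proof (cases "t = 0 \<or> t = 1")
  case False
  then have t: "0 < t" "t < 1" using assms by auto
  then have "f ((1 - t) *\<^sub>R x + t *\<^sub>R y) \<le> ereal (1 - t) * f x + ereal t * f y"
    using assms(1) by (auto simp: proper_convex_lsc_def convex_fun_def)
  also have "\<dots> \<le> ereal (1 - t) * ereal r + ereal t * ereal s"
    using assms(2,3) t by (intro add_mono ereal_mult_left_mono) auto
  finally show ?thesis by simp
qed (use assms in auto)

text \<open>For \<open>x \<noteq> y\<close> the graph over the finite values is the segment from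
  \<open>(x, r)\<close> to \<open>(y, s)\<close>. Elsewhere the infimum is over the empty set, which
  gives \<open>\<infinity>\<close>.\<close>

definition seg :: "'a::real_vector \<Rightarrow> real \<Rightarrow> 'a \<Rightarrow> real \<Rightarrow> 'a \<Rightarrow> ereal" where
  "seg x r y s z =
    (INF t\<in>{t. 0 \<le> t \<and> t \<le> 1 \<and> z = (1 - t) *\<^sub>R x + t *\<^sub>R y}. ereal ((1 - t) * r + t * s))"

text \<open>All terms of the infimum agree: for \<open>x \<noteq> y\<close> the parameter is
  determined by the point, and for \<open>x = y\<close> the height is constant.\<close>

lemma seg_at:
  assumes "x \<noteq> y \<or> r = s" "0 \<le> t" "t \<le> 1"
  shows "seg x r y s ((1 - t) *\<^sub>R x + t *\<^sub>R y) = ereal ((1 - t) * r + t * s)"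
proof -
  have *: "(1 - t') * r + t' * s = (1 - t) * r + t * s"
    if "(1 - t) *\<^sub>R x + t *\<^sub>R y = (1 - t') *\<^sub>R x + t' *\<^sub>R y" for t'
  proof (cases "x = y")
    case False
    have "(t - t') *\<^sub>R (y - x) = 0" using that by (simp add: algebra_simps)
    then show ?thesis using False by simp
  qed (use assms in \<open>simp add: algebra_simps\<close>)
  show ?thesis
    unfolding seg_def
  proof (rule antisym)
    let ?T = "{t'. 0 \<le> t' \<and> t' \<le> 1 \<and>
      (1 - t) *\<^sub>R x + t *\<^sub>R y = (1 - t') *\<^sub>R x + t' *\<^sub>R y}"
    show "(INF t'\<in>?T. ereal ((1 - t') * r + t' * s)) \<le> ereal ((1 - t) * r + t * s)"
      by (rule INF_lower) (use assms(2,3) in simp)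
    show "ereal ((1 - t) * r + t * s) \<le> (INF t'\<in>?T. ereal ((1 - t') * r + t' * s))"
    proof (rule INF_greatest)
      fix t' assume "t' \<in> ?T"
      then have "(1 - t') * r + t' * s = (1 - t) * r + t * s" by (intro *) simp
      then show "ereal ((1 - t) * r + t * s) \<le> ereal ((1 - t') * r + t' * s)" by simp
    qed
  qed
qed

lemma seg_finite:
  assumes "seg x r y s z \<noteq> \<infinity>"
  obtains t where "0 \<le> t" "t \<le> 1" "z = (1 - t) *\<^sub>R x + t *\<^sub>R y"
proof -
  have "{t. 0 \<le> t \<and> t \<le> 1 \<and> z = (1 - t) *\<^sub>R x + t *\<^sub>R y} \<noteq> {}"
    using assms unfolding seg_def by (metis INF_empty top_ereal_def)
  then show ?thesis using that by blast
qed

lemma seg_mem: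
  fixes x y :: "'a::locally_convex_space"
  assumes xy: "x \<noteq> y \<or> r = s"
  shows "seg x r y s \<in> proper_convex_lsc"
proof -
  let ?f = "seg x r y s" and ?P = "\<lambda>t. (1 - t) *\<^sub>R x + t *\<^sub>R y"
  have not_MInf: "?f z \<noteq> -\<infinity>" for z
  proof (cases "?f z = \<infinity>")
    case False
    then obtain t where "0 \<le> t" "t \<le> 1" "z = ?P t" by (rule seg_finite)
    then show ?thesis using seg_at[OF xy] by simp
  qed simp
  moreover have "?f (?P 0) \<noteq> \<infinity>" using seg_at[OF xy, of 0] by simp
  ultimately have "proper_fun ?f" by (auto simp: proper_fun_def)
  moreover have "convex_fun ?f"
    unfolding convex_fun_def
  proof (safe, rule ereal_le_convex_combI)
    fix z w :: 'a and u m n :: real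
    assume u: "0 < u" "u < 1" and zw: "?f z = ereal m" "?f w = ereal n"
    obtain t where t: "0 \<le> t" "t \<le> 1" "z = ?P t" using zw seg_finite[of x r y s z] by auto
    obtain t' where t': "0 \<le> t'" "t' \<le> 1" "w = ?P t'" using zw seg_finite[of x r y s w] by auto
    define v where "v = (1 - u) * t + u * t'"
    have "v \<le> (1 - u) * 1 + u * 1" "0 \<le> v"
      unfolding v_def using u t t' by (intro add_mono mult_left_mono add_nonneg_nonneg; simp)+
    moreover have "(1 - u) *\<^sub>R z + u *\<^sub>R w = ?P v"
      unfolding v_def t(3) t'(3) by (simp add: algebra_simps)
    ultimately have "?f ((1 - u) *\<^sub>R z + u *\<^sub>R w) = ereal ((1 - v) * r + v * s)"
      using seg_at[OF xy, of v] by simp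
    moreover have mn: "m = (1 - t) * r + t * s" "n = (1 - t') * r + t' * s"
      using zw t t' seg_at[OF xy] by auto
    have "(1 - u) * m + u * n = (1 - v) * r + v * s"
      unfolding mn v_def by (simp add: algebra_simps)
    ultimately show "?f ((1 - u) *\<^sub>R z + u *\<^sub>R w) \<le> ereal ((1 - u) * m + u * n)"
      by simp
  qed (use not_MInf in auto)
  moreover have "lsc_fun ?f"
    unfolding lsc_fun_def
  proof
    fix a
    \<comment> \<open>Sublevel sets are continuous images of compact parts of the unit interval,
      hence closed in a Hausdorff space. For \<open>a = \<infinity>\<close> the sublevel set is the
      whole space.\<close>
    have eq: "{z. ?f z \<le> a} = ?P ` ({0..1} \<inter> {t. ereal ((1 - t) * r + t * s) \<le> a})" if "a \<noteq> \<infinity>"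
    proof (intro equalityI subsetI)
      fix z assume "z \<in> {z. ?f z \<le> a}"
      then have z: "?f z \<le> a" by simp
      with that have "?f z \<noteq> \<infinity>" by auto
      then obtain t where t: "0 \<le> t" "t \<le> 1" "z = ?P t" by (rule seg_finite)
      then show "z \<in> ?P ` ({0..1} \<inter> {t. ereal ((1 - t) * r + t * s) \<le> a})"
        using z seg_at[OF xy t(1,2)] by (intro image_eqI[of _ _ t]) simp_all
    next
      fix z assume "z \<in> ?P ` ({0..1} \<inter> {t. ereal ((1 - t) * r + t * s) \<le> a})"
      then obtain t where "z = ?P t" "t \<in> {0..1} \<inter> {t. ereal ((1 - t) * r + t * s) \<le> a}"
        by (rule imageE)
      then show "z \<in> {z. ?f z \<le> a}" using seg_at[OF xy, of t] by simp
    qed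
    have "closed {z. ?f z \<le> a}"
    proof (cases "a = \<infinity>")
      case False
      have cpt: "compact ({0..1} \<inter> {t. ereal ((1 - t) * r + t * s) \<le> a})"
        by (intro compact_Int_closed compact_Icc closed_Collect_le continuous_intros)
      have "compact {z. ?f z \<le> a}"
        unfolding eq[OF False]
        by (rule compact_continuous_image[OF _ cpt])
          (intro continuous_on_add continuous_on_scaleR_lcs continuous_on_diff continuous_on_const
            continuous_on_id)
      then show ?thesis by (rule compact_imp_closed)
    qed simp
    then show "open {z. a < ?f z}" by (simp add: closed_def Compl_eq not_le)
  qed
  ultimately show ?thesis by (simp add: proper_convex_lsc_def)
qed

text \<open>Convexity carries the bounds at the endpoints along the segment.\<close>

lemma le_seg_iff:
  assumes "h \<in> proper_convex_lsc" "x \<noteq> y \<or> r = s"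
  shows "h \<le> seg x r y s \<longleftrightarrow> h x \<le> ereal r \<and> h y \<le> ereal s"
proof
  assume "h \<le> seg x r y s"
  then have "h ((1 - t) *\<^sub>R x + t *\<^sub>R y) \<le> ereal ((1 - t) * r + t * s)" if "0 \<le> t" "t \<le> 1" for t
    using seg_at[OF assms(2) that] by (metis le_funD)
  from this[of 0] this[of 1] show "h x \<le> ereal r \<and> h y \<le> ereal s" by simp
next
  assume h: "h x \<le> ereal r \<and> h y \<le> ereal s"
  show "h \<le> seg x r y s"
    unfolding seg_def le_fun_def using convex_funD[OF assms(1)] h by (auto intro!: INF_greatest)
qed

section \<open>Point functions and their characterization by the order\<close>

definition pt :: "'a::real_vector \<Rightarrow> real \<Rightarrow> 'a \<Rightarrow> ereal" where
  "pt x r z = (if z = x then ereal r else \<infinity>)"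

lemma pt_eq_seg: "pt x r = seg x r x r"
proof
  fix z
  show "pt x r z = seg x r x r z"
  proof (cases "z = x")
    case True
    then show ?thesis using seg_at[of x x r r 0] by (simp add: pt_def)
  next
    case False
    have "seg x r x r z = \<infinity>"
    proof (rule ccontr)
      assume "seg x r x r z \<noteq> \<infinity>"
      then obtain t where "z = (1 - t) *\<^sub>R x + t *\<^sub>R x" by (rule seg_finite)
      then show False using False by (simp add: algebra_simps)
    qed
    then show ?thesis using False by (simp add: pt_def)
  qed
qed

lemma pt_mem: "pt x r \<in> proper_convex_lsc" for x :: "'a::locally_convex_space"
  unfolding pt_eq_seg by (rule seg_mem) simp

text \<open>Point functions express evaluation through the order, which is all that an order
  isomorphism sees.\<close>

lemma le_pt_iff: "h \<le> pt x r \<longleftrightarrow> h x \<le> ereal r"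
  by (auto simp: le_fun_def pt_def)

lemma pt_le_pt_iff: "pt x r \<le> pt y s \<longleftrightarrow> x = y \<and> r \<le> s"
  by (auto simp: le_pt_iff pt_def)

lemma pt_le_imp_pt:
  assumes "proper_fun h" "pt x r \<le> h"
  obtains s where "h = pt x s"
proof -
  have inf: "h z = \<infinity>" if "z \<noteq> x" for z using le_funD[OF assms(2), of z] that by (simp add: pt_def)
  then obtain s where "h x = ereal s"
    using assms(1) unfolding proper_fun_def by (metis ereal_cases)
  then have "h = pt x s" using inf by (auto simp: pt_def fun_eq_iff)
  then show ?thesis by (rule that)
qed

text \<open>Finiteness at two points would put two incomparable point functions above
  \<open>f\<close>. The chain condition speaks of the order alone, so \<open>J\<close> transports
  it.\<close>

lemma pt_iff_chain:
  fixes f :: "'a::locally_convex_space \<Rightarrow> ereal"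
  assumes f: "f \<in> proper_convex_lsc"
  shows "(\<exists>x r. f = pt x r) \<longleftrightarrow>
    (\<forall>h\<in>proper_convex_lsc. \<forall>k\<in>proper_convex_lsc. f \<le> h \<longrightarrow> f \<le> k \<longrightarrow> h \<le> k \<or> k \<le> h)"
proof (intro iffI ballI impI)
  fix h k :: "'a \<Rightarrow> ereal"
  assume "\<exists>x r. f = pt x r" "h \<in> proper_convex_lsc" "k \<in> proper_convex_lsc" "f \<le> h" "f \<le> k"
  then obtain x r s where "h = pt x r" "k = pt x s"
    using pt_le_imp_pt unfolding proper_convex_lsc_def by (metis (no_types, lifting) mem_Collect_eq)
  then show "h \<le> k \<or> k \<le> h" by (auto simp: pt_le_pt_iff)
next
  assume chain: "\<forall>h\<in>proper_convex_lsc. \<forall>k\<in>proper_convex_lsc.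
    f \<le> h \<longrightarrow> f \<le> k \<longrightarrow> h \<le> k \<or> k \<le> h"
  have proper: "proper_fun f" using f by (simp add: proper_convex_lsc_def)
  then obtain x where "f x \<noteq> \<infinity>" "f x \<noteq> -\<infinity>" by (auto simp: proper_fun_def)
  then obtain r where r: "f x = ereal r" by (cases "f x") auto
  have "f y = \<infinity>" if "y \<noteq> x" for y
  proof (rule ccontr)
    assume "f y \<noteq> \<infinity>"
    then obtain s where "f y = ereal s" using proper by (cases "f y") (auto simp: proper_fun_def)
    then have "f \<le> pt y s" "f \<le> pt x r" using r by (simp_all add: le_pt_iff)
    then have "pt y s \<le> pt x r \<or> pt x r \<le> pt y s" using chain pt_mem by blast
    then show False using that by (auto simp: pt_le_pt_iff)
  qed
  then have "f = pt x r" using r by (auto simp: pt_def fun_eq_iff)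
  then show "\<exists>x r. f = pt x r" by blast
qed

section \<open>Continuous linear functionals as members of the class\<close>

lemma dual_mem_proper_convex_lsc:
  assumes "p \<in> dual"
  shows "(\<lambda>x. ereal (p x)) \<in> proper_convex_lsc"
proof -
  have p: "linear p" "continuous_on UNIV p" using assms by (auto simp: dual_def)
  have "open {x. a < ereal (p x)}" for a
    using p(2) by (intro open_Collect_less continuous_intros)
  then show ?thesis
    by (auto simp: proper_convex_lsc_def proper_fun_def convex_fun_def lsc_fun_def
        linear_add[OF p(1)] linear_cmul[OF p(1)])
qed

lemma linear_lsc_fun_imp_dual:
  assumes "linear l" "f \<in> proper_convex_lsc" "\<And>x. f x = ereal (l x + k)"
  shows "l \<in> dual"
proof (rule linear_lsc_imp_dual[OF assms(1)])
  fix a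
  have "open {x. ereal (a + k) < f x}"
    using assms(2) by (auto simp: proper_convex_lsc_def lsc_fun_def)
  then show "open {x. a < l x}" by (simp add: assms(3))
qed

lemma dual_cmul: "p \<in> dual \<Longrightarrow> (\<lambda>x. c * p x) \<in> dual"
  by (auto simp: dual_def linear_compose_scale_right intro!: continuous_intros)
    (auto simp: linear_iff algebra_simps)

lemma dual_diff: "p \<in> dual \<Longrightarrow> q \<in> dual \<Longrightarrow> (\<lambda>x. p x - q x) \<in> dual"
  by (auto simp: dual_def linear_compose_sub intro!: continuous_intros)

section \<open>Affine maps are order isomorphisms\<close>

text \<open>Named because the inverse of such a map has the same shape.\<close>

definition affine_map where
  "affine_map A c b d \<delta> f x = ereal (b x) + ereal \<delta> + ereal d * f (A x + c)"

lemma affine_map_le_iff: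
  assumes "d > 0" "f (A x + c) \<noteq> -\<infinity>" "h (A x + c) \<noteq> -\<infinity>"
  shows "affine_map A c b d \<delta> f x \<le> affine_map A c b d \<delta> h x \<longleftrightarrow> f (A x + c) \<le> h (A x + c)"
  using assms by (cases "f (A x + c)"; cases "h (A x + c)") (auto simp: affine_map_def)

lemma affine_map_mem:
  fixes A :: "'a::locally_convex_space \<Rightarrow> 'a"
  assumes A: "linear A" "has_weak_star_adjoint A" "surj A" and b: "b \<in> dual" and d: "d > 0"
    and f: "f \<in> proper_convex_lsc"
  shows "affine_map A c b d \<delta> f \<in> proper_convex_lsc"
proof -
  let ?g = "affine_map A c b d \<delta> f"
  have f': "proper_fun f" "convex_fun f" "lsc_fun f" using f by (auto simp: proper_convex_lsc_def)
  have bl: "linear b" using b by (simp add: dual_def)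
  have "?g x \<noteq> -\<infinity>" for x
    using f'(1) d unfolding proper_fun_def affine_map_def by (cases "f (A x + c)") auto
  moreover obtain y where "f y \<noteq> \<infinity>" using f'(1) by (auto simp: proper_fun_def)
  moreover obtain x where "A x = y - c" using A(3) by (metis surjD)
  then have "A x + c = y" by simp
  ultimately have "?g x \<noteq> \<infinity>" "\<And>x. ?g x \<noteq> -\<infinity>"
    using d by (cases "f y"; simp add: affine_map_def)+
  then have "proper_fun ?g" by (auto simp: proper_fun_def)
  have "convex_fun ?g"
    unfolding convex_fun_def
  proof (safe, rule ereal_le_convex_combI)
    fix x y :: 'a and t r s :: real
    assume t: "0 < t" "t < 1" and rs: "?g x = ereal r" "?g y = ereal s"
    obtain r' s' where rs': "f (A x + c) = ereal r'" "f (A y + c) = ereal s'"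
      using rs d by (cases "f (A x + c)"; cases "f (A y + c)") (auto simp: affine_map_def)
    have "A ((1 - t) *\<^sub>R x + t *\<^sub>R y) + c = (1 - t) *\<^sub>R (A x + c) + t *\<^sub>R (A y + c)"
      by (simp only: linear_add[OF A(1)] linear_cmul[OF A(1)]) (simp add: algebra_simps)
    then have le: "f (A ((1 - t) *\<^sub>R x + t *\<^sub>R y) + c) \<le> ereal ((1 - t) * r' + t * s')"
      using convex_funD[OF f, of "A x + c" r' "A y + c" s' t] rs' t by simp
    have "?g ((1 - t) *\<^sub>R x + t *\<^sub>R y) \<le>
        ereal (b ((1 - t) *\<^sub>R x + t *\<^sub>R y)) + ereal \<delta> + ereal d * ereal ((1 - t) * r' + t * s')"
      unfolding affine_map_def using d le by (intro add_mono ereal_mult_left_mono) auto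
    also have "b ((1 - t) *\<^sub>R x + t *\<^sub>R y) = (1 - t) * b x + t * b y"
      by (simp only: linear_add[OF bl] linear_cmul[OF bl] real_scaleR_def)
    also have "ereal ((1 - t) * b x + t * b y) + ereal \<delta> + ereal d * ereal ((1 - t) * r' + t * s')
        = ereal ((1 - t) * r + t * s)"
      using rs rs' by (auto simp: affine_map_def algebra_simps)
    finally show "?g ((1 - t) *\<^sub>R x + t *\<^sub>R y) \<le> ereal ((1 - t) * r + t * s)" .
  qed (use \<open>\<And>x. ?g x \<noteq> -\<infinity>\<close> in auto)
  \<comment> \<open>Sublevel sets of \<open>f\<close> are closed and convex, so weak continuity of
    \<open>A\<close> suffices.\<close>
  have open_f: "open {x. ereal a < f (A x + c)}" for a
  proof -
    have "convex {y. f y \<le> ereal a}"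
    proof (rule convexI, safe)
      fix x y and u v :: real
      assume "0 \<le> u" "0 \<le> v" "u + v = 1" "f x \<le> ereal a" "f y \<le> ereal a"
      moreover from this have u: "u = 1 - v" by simp
      ultimately show "f (u *\<^sub>R x + v *\<^sub>R y) \<le> ereal a"
        using convex_funD[OF f, of x a y a v] unfolding u by (simp add: left_diff_distrib)
    qed
    moreover have "closed {y. f y \<le> ereal a}"
      using f'(3) by (simp add: closed_def Compl_eq not_le lsc_fun_def)
    ultimately have "closed {x. f (A x + c) \<le> ereal a}"
      using closed_affine_vimage[OF A(2), of "{y. f y \<le> ereal a}" c] by simp
    then show ?thesis by (simp add: closed_def Compl_eq not_le)
  qed
  have "open {x. a < ?g x}" for a
  proof (cases a)
    case (real a')
    \<comment> \<open>A sum exceeds \<open>a'\<close> iff some \<open>s\<close> separates the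
      contributions of the two summands; this turns the superlevel set into a union of open
      intersections.\<close>
    have "ereal a' < ?g x \<longleftrightarrow> (\<exists>s. s < b x + \<delta> \<and> ereal ((a' - s) / d) < f (A x + c))" for x
    proof (cases "f (A x + c)")
      case (real r)
      have "(a' - s) / d < r \<longleftrightarrow> a' - d * r < s" for s
        using d by (auto simp: pos_divide_less_eq mult.commute)
      then have "(\<exists>s. s < b x + \<delta> \<and> (a' - s) / d < r) \<longleftrightarrow> (\<exists>s. a' - d * r < s \<and> s < b x + \<delta>)"
        by auto
      also have "\<dots> \<longleftrightarrow> a' - d * r < b x + \<delta>" by (auto dest: dense)
      finally show ?thesis using real by (auto simp: affine_map_def)
    next
      case PInf
      have "\<exists>s. s < b x + \<delta>" by (rule lt_ex)
      then show ?thesis using d PInf by (simp add: affine_map_def)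
    qed (use f'(1) in \<open>simp add: proper_fun_def\<close>)
    then have "{x. a < ?g x} = (\<Union>s. {x. s < b x + \<delta>} \<inter> {x. ereal ((a' - s) / d) < f (A x + c)})"
      using real by auto
    moreover have "open {x. s < b x + \<delta>}" for s
      using b by (intro open_Collect_less continuous_intros) (simp add: dual_def)
    ultimately show ?thesis using open_f by (auto intro!: open_UN open_Int)
  qed (use \<open>\<And>x. ?g x \<noteq> -\<infinity>\<close> in simp_all)
  then have "lsc_fun ?g" by (simp add: lsc_fun_def)
  then show ?thesis
    using \<open>proper_fun ?g\<close> \<open>convex_fun ?g\<close> by (simp add: proper_convex_lsc_def)
qed

lemma affine_form_imp_order_isomorphism:
  fixes J :: "('a::locally_convex_space \<Rightarrow> ereal) \<Rightarrow> ('a \<Rightarrow> ereal)"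
  assumes "affine_form J"
  shows "order_isomorphism_on proper_convex_lsc J"
proof -
  obtain A B :: "'a \<Rightarrow> 'a" and c b d \<delta> where
    A: "linear A" "has_weak_star_adjoint A" and B: "linear B" "has_weak_star_adjoint B"
    and inv: "A \<circ> B = id" "B \<circ> A = id" and b: "b \<in> dual" and d: "d > 0"
    and J: "\<And>f x. f \<in> proper_convex_lsc \<Longrightarrow> J f x = affine_map A c b d \<delta> f x"
    using assms unfolding affine_form_def affine_map_def by blast
  have AB: "A (B x) = x" "B (A x) = x" for x using inv by (metis comp_apply id_apply)+
  have surj: "surj A" "surj B" using AB by (metis surjI)+
  have bl: "linear b" using b by (simp add: dual_def)
  \<comment> \<open>\<open>b'\<close> and \<open>\<delta>'\<close> come from solving for
    \<open>f\<close> at \<open>y = A x + c\<close>, where \<open>x = B y - B c\<close>.\<close>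
  define b' where "b' x = (- 1 / d) * b (B x)" for x
  define \<delta>' where "\<delta>' = (b (B c) - \<delta>) / d"
  let ?K = "affine_map B (- B c) b' (1 / d) \<delta>'"
  have b': "b' \<in> dual"
    unfolding b'_def by (intro dual_cmul has_weak_star_adjointD[OF B(2) b])
  have fin: "f x \<noteq> -\<infinity>" if "f \<in> proper_convex_lsc" for f and x :: 'a
    using that by (simp add: proper_convex_lsc_def proper_fun_def)
  have Jeq: "J f = affine_map A c b d \<delta> f" if "f \<in> proper_convex_lsc" for f
    using J[OF that] by blast
  have Jmem: "J f \<in> proper_convex_lsc" if "f \<in> proper_convex_lsc" for f
    using affine_map_mem[OF A surj(1) b d that] Jeq[OF that] by simp
  have Kmem: "?K f \<in> proper_convex_lsc" if "f \<in> proper_convex_lsc" for f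
    using affine_map_mem[OF B surj(2) b' _ that] d by simp
  have KJ: "?K (J f) = f" if f: "f \<in> proper_convex_lsc" for f
  proof
    fix x
    have *: "A (B x + - B c) + c = x" by (simp add: linear_diff[OF A(1)] AB)
    have b_eq: "b (B x + - B c) = b (B x) - b (B c)" by (simp add: linear_diff[OF bl])
    show "?K (J f) x = f x"
      unfolding affine_map_def J[OF f] * b_eq b'_def \<delta>'_def
      using fin[OF f, of x] d by (cases "f x") (auto simp: field_simps)
  qed
  have JK: "J (?K f) = f" if f: "f \<in> proper_convex_lsc" for f
  proof
    fix x
    have *: "B (A x + c) + - B c = x" by (simp add: linear_add[OF B(1)] AB)
    have b_eq: "b (B (A x + c)) = b x + b (B c)"
      by (simp add: linear_add[OF B(1)] linear_add[OF bl] AB)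
    show "J (?K f) x = f x"
      unfolding J[OF Kmem[OF f]] unfolding affine_map_def * b'_def b_eq \<delta>'_def
      using fin[OF f, of x] d by (cases "f x") (auto simp: field_simps)
  qed
  have "bij_betw J proper_convex_lsc proper_convex_lsc"
    using Jmem Kmem KJ JK by (intro bij_betw_byWitness[of _ ?K]) auto
  moreover have "h \<le> f \<longleftrightarrow> J h \<le> J f"
    if f: "f \<in> proper_convex_lsc" and h: "h \<in> proper_convex_lsc" for f h
  proof -
    have "J h \<le> J f \<longleftrightarrow> (\<forall>x. h (A x + c) \<le> f (A x + c))"
      by (simp add: le_fun_def J[OF f] J[OF h] affine_map_le_iff d fin[OF f] fin[OF h])
    also have "\<dots> \<longleftrightarrow> (\<forall>y. h y \<le> f y)"
    proof safe
      fix y assume "\<forall>x. h (A x + c) \<le> f (A x + c)"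
      from this[rule_format, of "B (y - c)"] show "h y \<le> f y" by (simp add: AB)
    qed simp
    finally show ?thesis by (simp add: le_fun_def)
  qed
  ultimately show ?thesis by (simp add: order_isomorphism_on_def)
qed

section \<open>Order isomorphisms act pointwise\<close>

locale convex_order_iso =
  fixes J :: "('a::locally_convex_space \<Rightarrow> ereal) \<Rightarrow> ('a \<Rightarrow> ereal)"
  assumes iso: "order_isomorphism_on proper_convex_lsc J"
begin

lemma J_mem: "f \<in> proper_convex_lsc \<Longrightarrow> J f \<in> proper_convex_lsc"
  using iso unfolding order_isomorphism_on_def bij_betw_def by blast

lemma J_le_iff:
  "f \<in> proper_convex_lsc \<Longrightarrow> h \<in> proper_convex_lsc \<Longrightarrow> J f \<le> J h \<longleftrightarrow> f \<le> h"
  using iso unfolding order_isomorphism_on_def by blast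

lemma J_surj:
  assumes "h \<in> proper_convex_lsc"
  obtains f where "f \<in> proper_convex_lsc" "h = J f"
  using assms iso unfolding order_isomorphism_on_def bij_betw_def by blast

lemma J_pt_iff:
  assumes f: "f \<in> proper_convex_lsc"
  shows "(\<exists>y s. J f = pt y s) \<longleftrightarrow> (\<exists>x r. f = pt x r)"
proof -
  \<comment> \<open>\<open>J\<close> maps the class onto itself, so quantifiers over the class can
    be reindexed by \<open>J\<close>.\<close>
  have ball: "(\<forall>h\<in>proper_convex_lsc. P h) \<longleftrightarrow> (\<forall>h\<in>proper_convex_lsc. P (J h))" for P
    using J_mem J_surj by metis
  show ?thesis
    unfolding pt_iff_chain[OF f] pt_iff_chain[OF J_mem[OF f]]
    by (subst ball, subst (2) ball) (simp add: J_le_iff f J_mem)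
qed

text \<open>The height \<open>0\<close> is an arbitrary choice; \<open>J_pt\<close> shows that every
  height leads to the same base point.\<close>

definition \<phi> :: "'a \<Rightarrow> 'a" where "\<phi> x = (SOME y. \<exists>s. J (pt x 0) = pt y s)"

definition g :: "'a \<Rightarrow> real \<Rightarrow> real" where "g x r = (SOME s. J (pt x r) = pt (\<phi> x) s)"

lemma J_pt: "J (pt x r) = pt (\<phi> x) (g x r)"
proof -
  have ex: "\<exists>y s. J (pt x r) = pt y s" for r using J_pt_iff[OF pt_mem] by blast
  have *: "\<exists>s. J (pt x 0) = pt (\<phi> x) s" unfolding \<phi>_def by (rule someI_ex[OF ex])
  then obtain s where s: "J (pt x 0) = pt (\<phi> x) s" by blast
  obtain y s' where s': "J (pt x r) = pt y s'" using ex by blast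
  \<comment> \<open>Comparable point functions have comparable images, and these must share their
    base point.\<close>
  have "pt x r \<le> pt x 0 \<or> pt x 0 \<le> pt x r" by (auto simp: pt_le_pt_iff)
  then have "J (pt x r) \<le> J (pt x 0) \<or> J (pt x 0) \<le> J (pt x r)" by (simp add: J_le_iff pt_mem)
  then have "y = \<phi> x" unfolding s s' by (auto simp: pt_le_pt_iff)
  then have "\<exists>s. J (pt x r) = pt (\<phi> x) s" using s' by blast
  then show ?thesis unfolding g_def by (rule someI_ex)
qed

lemma J_apply_le_iff:
  assumes "f \<in> proper_convex_lsc"
  shows "J f (\<phi> x) \<le> ereal (g x r) \<longleftrightarrow> f x \<le> ereal r"
  using J_le_iff[OF assms pt_mem, of x r] by (simp add: J_pt le_pt_iff)

lemma g_le_iff: "g x r \<le> g x s \<longleftrightarrow> r \<le> s"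
  using J_apply_le_iff[OF pt_mem, of x r x s] by (simp add: J_pt) (simp add: pt_def)

lemma inj_\<phi>: "inj \<phi>"
proof (rule injI)
  fix x y assume "\<phi> x = \<phi> y"
  then have "J (pt x 0) \<le> J (pt y 0) \<or> J (pt y 0) \<le> J (pt x 0)"
    by (auto simp: J_pt pt_le_pt_iff)
  then show "x = y" by (auto simp: J_le_iff pt_mem pt_le_pt_iff)
qed

lemma pt_in_range:
  obtains x r where "\<phi> x = y" "g x r = s"
proof -
  obtain f where f: "f \<in> proper_convex_lsc" "pt y s = J f" using J_surj[OF pt_mem] .
  have "\<exists>y s. J f = pt y s" by (intro exI) (rule f(2)[symmetric])
  then obtain x r where "f = pt x r" unfolding J_pt_iff[OF f(1)] by blast
  then have "pt y s = pt (\<phi> x) (g x r)" using f(2) J_pt by simp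
  then have "pt y s \<le> pt (\<phi> x) (g x r)" "pt (\<phi> x) (g x r) \<le> pt y s" by simp_all
  then show ?thesis unfolding pt_le_pt_iff by (intro that[of x r]) simp_all
qed

lemma bij_\<phi>: "bij \<phi>"
proof (rule bijI[OF inj_\<phi>])
  show "surj \<phi>" unfolding surj_def using pt_in_range by metis
qed

lemma surj_g: "surj (g x)"
proof (rule surjI)
  fix s
  have "\<exists>r. g x r = s"
    using pt_in_range[of "\<phi> x" s] injD[OF inj_\<phi>] by metis
  then show "g x (SOME r. g x r = s) = s" by (rule someI_ex)
qed

text \<open>The segment function is the infimum of two point functions, and \<open>J\<close> preserves infima.\<close>

lemma J_seg:
  assumes "x \<noteq> y"
  shows "J (seg x r y s) = seg (\<phi> x) (g x r) (\<phi> y) (g y s)"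
proof -
  let ?k = "seg (\<phi> x) (g x r) (\<phi> y) (g y s)"
  have neq: "\<phi> x \<noteq> \<phi> y" using assms inj_\<phi> by (auto dest: injD)
  have k: "?k \<in> proper_convex_lsc" using neq by (intro seg_mem) simp
  have m: "seg x r y s \<in> proper_convex_lsc" using assms by (intro seg_mem) simp
  \<comment> \<open>Both functions have the same lower bounds in the class; each of them is then
    tested as a lower bound of the other.\<close>
  have *: "J h \<le> J (seg x r y s) \<longleftrightarrow> J h \<le> ?k" if h: "h \<in> proper_convex_lsc" for h
    using assms neq h m
    by (simp add: J_le_iff J_mem le_seg_iff J_apply_le_iff)
  obtain h where h: "h \<in> proper_convex_lsc" "?k = J h" using J_surj[OF k] .
  show ?thesis
    using *[OF m] *[OF h(1)] h(2) by (intro antisym) auto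
qed

text \<open>The position \<open>u\<close> is fixed by the base points alone, so one \<open>u\<close>
  serves all heights \<open>r\<close> and \<open>s\<close>; this makes the relation a functional
  equation.\<close>

lemma segment_equation:
  assumes xy: "x \<noteq> y" and t: "0 \<le> t" "t \<le> 1"
  obtains u where "0 \<le> u" "u \<le> 1"
    "\<phi> ((1 - t) *\<^sub>R x + t *\<^sub>R y) = (1 - u) *\<^sub>R \<phi> x + u *\<^sub>R \<phi> y"
    "\<And>r s. g ((1 - t) *\<^sub>R x + t *\<^sub>R y) ((1 - t) * r + t * s) = (1 - u) * g x r + u * g y s"
proof -
  let ?z = "(1 - t) *\<^sub>R x + t *\<^sub>R y"
  have neq: "\<phi> x \<noteq> \<phi> y" using xy inj_\<phi> by (auto dest: injD)
  have m: "seg x r y s \<in> proper_convex_lsc" for r s using xy by (intro seg_mem) simp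
  have le_iff: "seg (\<phi> x) (g x r) (\<phi> y) (g y s) (\<phi> ?z) \<le> ereal (g ?z v) \<longleftrightarrow>
      (1 - t) * r + t * s \<le> v" for r s v
    using J_apply_le_iff[OF m, of r s ?z v] seg_at[of x y r s t] xy t
    by (simp add: J_seg[OF xy])
  \<comment> \<open>Zero heights suffice to locate \<open>\<phi> ?z\<close> on the segment between
    \<open>\<phi> x\<close> and \<open>\<phi> y\<close>.\<close>
  have "seg (\<phi> x) (g x 0) (\<phi> y) (g y 0) (\<phi> ?z) \<le> ereal (g ?z 0)"
    using le_iff[of 0 0 0] by simp
  then have "seg (\<phi> x) (g x 0) (\<phi> y) (g y 0) (\<phi> ?z) \<noteq> \<infinity>" by auto
  then obtain u where u: "0 \<le> u" "u \<le> 1" "\<phi> ?z = (1 - u) *\<^sub>R \<phi> x + u *\<^sub>R \<phi> y"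
    by (rule seg_finite)
  have "g ?z ((1 - t) * r + t * s) = (1 - u) * g x r + u * g y s" for r s
  proof -
    have le: "(1 - u) * g x r + u * g y s \<le> g ?z v \<longleftrightarrow> (1 - t) * r + t * s \<le> v" for v
      using le_iff[of r s v] seg_at[of "\<phi> x" "\<phi> y" "g x r" "g y s" u] neq u by simp
    \<comment> \<open>Surjectivity makes the right side a value of \<open>g ?z\<close>, so comparing
      arguments decides equality.\<close>
    obtain v where v: "(1 - u) * g x r + u * g y s = g ?z v" using surjD[OF surj_g] by blast
    then have "(1 - t) * r + t * s \<le> v" using le[of v] by simp
    then have "g ?z ((1 - t) * r + t * s) \<le> g ?z v" by (simp only: g_le_iff)
    then show ?thesis using le[of "(1 - t) * r + t * s"] v by simp
  qed
  then show ?thesis using u that by blast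
qed

end

section \<open>Order isomorphisms are affine\<close>

text \<open>On the zero space the class is a copy of the reals, and every increasing bijection of
  the reals is an order isomorphism, affine or not. A second base point is what makes
  \<open>g_affine\<close> work.\<close>

locale nontrivial_convex_order_iso = convex_order_iso J
  for J :: "('a::locally_convex_space \<Rightarrow> ereal) \<Rightarrow> ('a \<Rightarrow> ereal)" +
  assumes nontrivial: "\<exists>x::'a. x \<noteq> 0"
begin

definition e :: "'a \<Rightarrow> real" where "e x = g x 0"

definition slope :: "'a \<Rightarrow> real" where "slope x = g x 1 - g x 0"

lemma slope_pos: "slope x > 0"
  using g_le_iff[of x 1 0] by (simp add: slope_def)

lemma g_affine: "g x r = e x + r * slope x"
proof -
  obtain a :: 'a where "a \<noteq> 0" using nontrivial by blast
  then have neq: "x \<noteq> x + a" by simp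
  \<comment> \<open>At the midpoint the left side depends only on \<open>r + s\<close>, which is the
    Pexider form.\<close>
  define z where "z = (1 - 1 / 2) *\<^sub>R x + (1 / 2) *\<^sub>R (x + a)"
  have half: "0 \<le> (1 / 2 :: real)" "1 / 2 \<le> (1 :: real)" by simp_all
  obtain u where u: "0 \<le> u" "u \<le> 1"
    and "\<And>r s. g z ((1 - 1 / 2) * r + 1 / 2 * s) = (1 - u) * g x r + u * g (x + a) s"
    unfolding z_def using segment_equation[OF neq half] by metis
  then have eq: "g z (r / 2 + s / 2) = (1 - u) * g x r + u * g (x + a) s" for r s by simp
  \<comment> \<open>For \<open>u = 1\<close> the right side would not depend on \<open>r\<close>,
    against strict monotonicity of \<open>g z\<close>. The factor \<open>1 - u\<close> is cancelled
    at the end.\<close>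
  have "u \<noteq> 1"
  proof
    assume "u = 1"
    then have "g z (1/2) = g z 0" using eq[of 1 0] eq[of 0 0] by simp
    then show False using g_le_iff[of z "1/2" 0] by simp
  qed
  have "mono (\<lambda>r. (1 - u) * g x r)"
    using u by (intro monoI mult_left_mono) (auto simp: g_le_iff)
  moreover have "g z ((r + s) / 2) = (1 - u) * g x r + u * g (x + a) s" for r s
    using eq[of r s] by (simp add: add_divide_distrib)
  ultimately have "(1 - u) * g x r = (1 - u) * g x 0 + r * ((1 - u) * g x 1 - (1 - u) * g x 0)"
    by (intro pexider_mono_affine[where g = "\<lambda>r. g z (r / 2)" and b = "\<lambda>s. u * g (x + a) s"])
  also have "\<dots> = (1 - u) * (g x 0 + r * (g x 1 - g x 0))" by (simp add: algebra_simps)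
  finally show ?thesis using \<open>u \<noteq> 1\<close> by (simp add: e_def slope_def)
qed

definition d :: real where "d = slope 0"

text \<open>On a segment \<open>1 / slope\<close> is affine, hence constant, being positive on the whole space.\<close>

lemma slope_eq_d: "slope x = d"
proof -
  have "1 / slope ((1 - t) *\<^sub>R x + t *\<^sub>R y) = (1 - t) * (1 / slope x) + t * (1 / slope y)"
    if t: "0 \<le> t" "t \<le> 1" for x y t
  proof (cases "x = y")
    case True
    then have "(1 - t) *\<^sub>R x + t *\<^sub>R y = x" by (simp add: algebra_simps)
    then show ?thesis using True by (simp add: algebra_simps add_divide_distrib[symmetric])
  next
    case False
    let ?z = "(1 - t) *\<^sub>R x + t *\<^sub>R y"
    obtain u where
      eq: "\<And>r s. g ?z ((1 - t) * r + t * s) = (1 - u) * g x r + u * g y s"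
      using segment_equation[OF False t] by metis
    \<comment> \<open>Varying \<open>r\<close> alone and then \<open>s\<close> alone gives two
      relations between slopes; adding their reciprocal forms eliminates \<open>u\<close>.\<close>
    have 1: "(1 - t) * slope ?z = (1 - u) * slope x"
      using eq[of 1 0] eq[of 0 0] by (simp add: g_affine algebra_simps)
    have 2: "t * slope ?z = u * slope y"
      using eq[of 0 1] eq[of 0 0] by (simp add: g_affine algebra_simps)
    have "(1 - t) / slope x = (1 - u) / slope ?z" "t / slope y = u / slope ?z"
      using 1 2 slope_pos[of x] slope_pos[of y] slope_pos[of ?z] by (simp_all add: field_simps)
    then show ?thesis by (simp add: add_divide_distrib[symmetric])
  qed
  then have "1 / slope x = 1 / slope 0"
    by (rule positive_affine_const) (simp_all add: slope_pos)
  then show ?thesis by (simp add: d_def)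
qed

lemma d_pos: "d > 0"
  using slope_pos[of 0] by (simp add: d_def)

text \<open>With equal slopes, varying one height in the segment equation forces
  \<open>u = t\<close>.\<close>

lemma \<phi>_e_affine:
  assumes t: "0 \<le> t" "t \<le> 1"
  shows "\<phi> ((1 - t) *\<^sub>R x + t *\<^sub>R y) = (1 - t) *\<^sub>R \<phi> x + t *\<^sub>R \<phi> y"
    and "e ((1 - t) *\<^sub>R x + t *\<^sub>R y) = (1 - t) * e x + t * e y"
proof -
  let ?z = "(1 - t) *\<^sub>R x + t *\<^sub>R y"
  have "\<phi> ?z = (1 - t) *\<^sub>R \<phi> x + t *\<^sub>R \<phi> y \<and> e ?z = (1 - t) * e x + t * e y"
  proof (cases "x = y")
    case True
    then have "?z = x" by (simp add: algebra_simps)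
    then show ?thesis using True by (simp add: algebra_simps)
  next
    case False
    obtain u where \<phi>: "\<phi> ?z = (1 - u) *\<^sub>R \<phi> x + u *\<^sub>R \<phi> y" and
      eq: "\<And>r s. g ?z ((1 - t) * r + t * s) = (1 - u) * g x r + u * g y s"
      using segment_equation[OF False t] by metis
    have "t * d = u * d"
      using eq[of 0 1] eq[of 0 0] by (simp add: g_affine slope_eq_d algebra_simps)
    then have "u = t" using d_pos by simp
    then show ?thesis using \<phi> eq[of 0 0] by (simp add: e_def)
  qed
  then show "\<phi> ?z = (1 - t) *\<^sub>R \<phi> x + t *\<^sub>R \<phi> y" "e ?z = (1 - t) * e x + t * e y" by auto
qed

text \<open>A value other than \<open>-\<infinity>\<close> is determined by its real upper bounds,
  and these correspond under \<open>r \<mapsto> e x + r * d\<close>.\<close>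

lemma J_apply:
  assumes f: "f \<in> proper_convex_lsc"
  shows "J f (\<phi> x) = ereal (e x) + ereal d * f x"
proof -
  have le_iff: "J f (\<phi> x) \<le> ereal (e x + r * d) \<longleftrightarrow> f x \<le> ereal r" for r
    using J_apply_le_iff[OF f, of x r] by (simp add: g_affine slope_eq_d)
  have le_iff': "J f (\<phi> x) \<le> ereal r \<longleftrightarrow> f x \<le> ereal ((r - e x) / d)" for r
    using le_iff[of "(r - e x) / d"] d_pos by simp
  have ninf: "f x \<noteq> -\<infinity>" "J f (\<phi> x) \<noteq> -\<infinity>"
    using f J_mem[OF f] by (auto simp: proper_convex_lsc_def proper_fun_def)
  show ?thesis
  proof (cases "f x")
    case (real r)
    then obtain s where s: "J f (\<phi> x) = ereal s"
      using le_iff[of r] ninf by (cases "J f (\<phi> x)") auto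
    then have "s \<le> e x + r * d" "r \<le> (s - e x) / d"
      using le_iff[of r] le_iff'[of s] real by simp_all
    then have "s = e x + r * d" using d_pos by (simp add: field_simps)
    then show ?thesis using s real by (simp add: mult.commute)
  next
    case PInf
    then have "J f (\<phi> x) = \<infinity>"
      using le_iff' ninf by (cases "J f (\<phi> x)") auto
    then show ?thesis using PInf d_pos by simp
  qed (use ninf in simp)
qed

lemma affine_form_J: "affine_form J"
proof -
  define \<psi> where "\<psi> = inv \<phi>"
  have \<psi>\<phi>: "\<psi> (\<phi> x) = x" and \<phi>\<psi>: "\<phi> (\<psi> x) = x" for x
    unfolding \<psi>_def using bij_\<phi> by (auto simp: bij_is_inj bij_is_surj surj_f_inv_f)
  have \<psi>_affine: "\<psi> ((1 - t) *\<^sub>R x + t *\<^sub>R y) = (1 - t) *\<^sub>R \<psi> x + t *\<^sub>R \<psi> y"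
    if "0 \<le> t" "t \<le> 1" for x y t
    using \<phi>_e_affine(1)[OF that, of "\<psi> x" "\<psi> y"] by (metis \<psi>\<phi> \<phi>\<psi>)
  \<comment> \<open>Writing the argument as \<open>\<phi> (\<psi> x)\<close> makes \<open>J\<close>
    evaluate \<open>f\<close> at \<open>\<psi> x\<close>; \<open>A\<close> and \<open>b\<close> are
    thus the linear parts of \<open>\<psi>\<close> and of \<open>e\<close> after
    \<open>\<psi>\<close>.\<close>
  define A B c b e' \<delta> where "A x = \<psi> x - \<psi> 0" and "B x = \<phi> x - \<phi> 0" and "c = \<psi> 0"
    and "b x = e (\<psi> x) - e (\<psi> 0)" and "e' x = e x - e 0" and "\<delta> = e (\<psi> 0)" for x
  have A: "linear A" and B: "linear B" and e': "linear e'" and b: "linear b"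
    unfolding A_def[abs_def] B_def[abs_def] e'_def[abs_def] b_def[abs_def]
    by (intro affine_imp_linear; simp add: \<psi>_affine \<phi>_e_affine)+
  have \<psi>_eq: "\<psi> x = A x + c" for x by (simp add: A_def c_def)
  have "A (B x) = x" for x
    unfolding B_def linear_diff[OF A] by (simp add: A_def \<psi>\<phi>)
  moreover have "B (A x) = x" for x
    unfolding A_def linear_diff[OF B] by (simp add: B_def \<phi>\<psi>)
  ultimately have inv: "A \<circ> B = id" "B \<circ> A = id" by auto
  have J: "J f x = ereal (b x) + ereal \<delta> + ereal d * f (A x + c)"
    if f: "f \<in> proper_convex_lsc" for f x
    using J_apply[OF f, of "\<psi> x"] by (simp add: \<phi>\<psi> \<psi>_eq[symmetric] b_def \<delta>_def)
  \<comment> \<open>\<open>J\<close> maps \<open>p\<close> to this linear form plus a constant. The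
    case \<open>p = 0\<close> isolates \<open>b\<close>, and subtracting it leaves a multiple of
    \<open>p\<close> composed with \<open>A\<close>.\<close>
  have pull: "(\<lambda>x. b x + d * p (A x)) \<in> dual" if p: "p \<in> dual" for p
  proof (rule linear_lsc_fun_imp_dual)
    have pl: "linear p" using p by (simp add: dual_def)
    show "linear (\<lambda>x. b x + d * p (A x))"
      by (intro linearI) (simp_all add: linear_add[OF pl] linear_add[OF A] linear_add[OF b]
          linear_cmul[OF pl] linear_cmul[OF A] linear_cmul[OF b] algebra_simps)
    show "J (\<lambda>x. ereal (p x)) \<in> proper_convex_lsc"
      by (intro J_mem dual_mem_proper_convex_lsc p)
    show "J (\<lambda>x. ereal (p x)) x = ereal (b x + d * p (A x) + (\<delta> + d * p c))" for x
      by (simp add: J dual_mem_proper_convex_lsc[OF p] linear_add[OF pl] algebra_simps)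
  qed
  have zero: "(\<lambda>x. 0) \<in> dual" by (simp add: dual_def linear_zero)
  have b_dual: "b \<in> dual" using pull[OF zero] by simp
  have A_adj: "has_weak_star_adjoint A"
  proof (rule has_weak_star_adjointI)
    fix p :: "'a \<Rightarrow> real" assume "p \<in> dual"
    from dual_cmul[OF dual_diff[OF pull[OF this] b_dual], of "1 / d"]
    show "(\<lambda>x. p (A x)) \<in> dual" using d_pos by simp
  qed
  \<comment> \<open>The same for the inverse: this is the linear part of the preimage of
    \<open>p\<close> under \<open>J\<close>.\<close>
  have push: "(\<lambda>x. (1 / d) * (p (B x) - e' x)) \<in> dual" if p: "p \<in> dual" for p
  proof -
    have pl: "linear p" using p by (simp add: dual_def)
    obtain f where f: "f \<in> proper_convex_lsc" "(\<lambda>x. ereal (p x)) = J f"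
      using J_surj[OF dual_mem_proper_convex_lsc[OF p]] .
    show ?thesis
    proof (rule linear_lsc_fun_imp_dual[OF _ f(1)])
      show "linear (\<lambda>x. (1 / d) * (p (B x) - e' x))"
        by (intro linearI) (simp_all add: linear_add[OF pl] linear_add[OF B] linear_add[OF e']
            linear_cmul[OF pl] linear_cmul[OF B] linear_cmul[OF e'] algebra_simps
            diff_divide_distrib add_divide_distrib)
      fix x
      have p_eq: "p (\<phi> x) = p (B x) + p (\<phi> 0)"
        by (simp add: B_def linear_diff[OF pl])
      have H: "ereal (p (\<phi> x)) = ereal (e x) + ereal d * f x"
        using J_apply[OF f(1), of x] fun_cong[OF f(2), of "\<phi> x"] by simp
      show "f x = ereal ((1 / d) * (p (B x) - e' x) + (p (\<phi> 0) - e 0) / d)"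
      proof (cases "f x")
        case (real r)
        have "(1 / d) * (p (B x) - e' x) + (p (\<phi> 0) - e 0) / d = (p (\<phi> x) - e x) / d"
          by (simp add: p_eq e'_def add_divide_distrib diff_divide_distrib)
        also have "\<dots> = r" using H real d_pos by (simp add: field_simps)
        finally show ?thesis using real by simp
      qed (use H d_pos in auto)
    qed
  qed
  have B_adj: "has_weak_star_adjoint B"
  proof (rule has_weak_star_adjointI)
    fix p :: "'a \<Rightarrow> real" assume "p \<in> dual"
    \<comment> \<open>Subtracting the form that belongs to the zero functional cancels
      \<open>e'\<close>.\<close>
    from dual_cmul[OF dual_diff[OF push[OF this] push[OF zero]], of d]
    show "(\<lambda>x. p (B x)) \<in> dual" using d_pos by (simp add: add_divide_distrib[symmetric])
  qed
  show ?thesis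
    unfolding affine_form_def
    by (rule exI[of _ A], rule exI[of _ B], rule exI[of _ c], rule exI[of _ b], rule exI[of _ d],
        rule exI[of _ \<delta>]) (intro conjI ballI allI A A_adj B B_adj inv b_dual d_pos J)
qed

end

theorem theorem41:
  fixes J :: "('a::locally_convex_space \<Rightarrow> ereal) \<Rightarrow> ('a \<Rightarrow> ereal)"
  shows "((\<exists>x::'a. x \<noteq> 0) \<longrightarrow> order_isomorphism_on proper_convex_lsc J \<longrightarrow> affine_form J) \<and>
    (affine_form J \<longrightarrow> order_isomorphism_on proper_convex_lsc J)"
proof (intro conjI impI)
  assume "\<exists>x::'a. x \<noteq> 0" "order_isomorphism_on proper_convex_lsc J"
  then interpret nontrivial_convex_order_iso J by unfold_locales
  show "affine_form J" by (rule affine_form_J)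
qed (rule affine_form_imp_order_isomorphism)

end
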